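(* Let $\mathcal{G}$ be a graph, let $I$ be an infinite index set, and let $\Pi\mathcal{G}=\prod_{i\in I}\mathcal{G}$ be the corresponding direct power. Then $\Pi\mathcal{G}$ is $\mathcal{L}_g(\Pi\mathcal{G})$-equationally Noetherian if and only if $\mathcal{G}$ satisfies the quasi-identity $$\forall x_1\forall x_2\forall x_3\forall x_4\;\bigl(E(x_1,x_2)\wedge E(x_2,x_3)\wedge E(x_3,x_4)\to E(x_4,x_1)\bigr).$$
   Context: The graph language is $\mathcal{L}_g=\{E^{(2)}\}$, with one binary relation symbol. A graph is an $\mathcal{L}_g$-structure (finite or infinite) satisfying $\forall x\,\neg E(x,x)$ and $\forall x\forall y\,(E(x,y)\to E(y,x))$. The direct power $\Pi\mathcal{A}=\prod_{i\in I}\mathcal{A}$ of a structure $\mathcal{A}$ consists of all families $[a_i\mid i\in I]$ with $a_i\in\mathcal{A}$; relations are defined coordinate-wise (a relation holds in $\Pi\mathcal{A}$ iff it holds in every coordinate $i\in I$). For an $\mathcal{L}$-structure $\mathcal{B}$, $\mathcal{L}(\mathcal{B})$ is the language $\mathcal{L}\cup\{b\mid b\in\mathcal{B}\}$ obtained by adding a constant symbol for every element of $\mathcal{B}$, interpreted by that element. An $\mathcal{L}(\mathcal{B})$-equation is an atomic formula of $\mathcal{L}(\mathcal{B})$ (equalities included). An $\mathcal{L}(\mathcal{B})$-system is an arbitrary set of $\mathcal{L}(\mathcal{B})$-equations in a finite set of variables $x_1,\dots,x_n$; its solution set over $\mathcal{B}$ is the set of points of $\mathcal{B}^n$ satisfying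 all its equations. Two systems in the same variables are equivalent over $\mathcal{B}$ if they have the same solution set. $\mathcal{B}$ is $\mathcal{L}(\mathcal{B})$-equationally Noetherian if every infinite $\mathcal{L}(\mathcal{B})$-system $\mathbf{S}$ is equivalent over $\mathcal{B}$ to some finite subsystem $\mathbf{S}'\subseteq\mathbf{S}$. *)

theory Defs
  imports Main "HOL-Library.FuncSet"
begin

text \<open>Structures for the language with one binary relation symbol.  The relation \<open>adj\<close> is only
  meaningful between elements of the universe; the universe may be empty.\<close>

record 'a Lg_structure =
  universe :: "'a set"
  adj :: "'a \<Rightarrow> 'a \<Rightarrow> bool"

definition is_graph :: "'a Lg_structure \<Rightarrow> bool" where
  "is_graph G \<longleftrightarrow>
     (\<forall>x\<in>universe G. \<not> adj G x x) \<and>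
     (\<forall>x\<in>universe G. \<forall>y\<in>universe G. adj G x y \<longrightarrow> adj G y x)"

definition direct_power :: "'i set \<Rightarrow> 'a Lg_structure \<Rightarrow> ('i \<Rightarrow> 'a) Lg_structure" where
  "direct_power I A =
     \<lparr> universe = (\<Pi>\<^sub>E i\<in>I. universe A),
       adj = (\<lambda>a b. \<forall>i\<in>I. adj A (a i) (b i)) \<rparr>"

text \<open>The language is relational, so the terms of its expansion by the elements of a structure
  are just variables and constants.\<close>

datatype 'b lg_term = Var nat | Const 'b

datatype 'b equation =
    Equal "'b lg_term" "'b lg_term"
  | Edge "'b lg_term" "'b lg_term"

text \<open>The variables $x_1, \dots, x_n$ are numbered from \<open>0\<close> to \<open>n - 1\<close>.\<close>

definition terms_over :: "'b Lg_structure \<Rightarrow> nat \<Rightarrow> 'b lg_term set" where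
  "terms_over B n = Var ` {..<n} \<union> Const ` universe B"

definition equations_over :: "'b Lg_structure \<Rightarrow> nat \<Rightarrow> 'b equation set" where
  "equations_over B n =
     {Equal s t | s t. s \<in> terms_over B n \<and> t \<in> terms_over B n} \<union>
     {Edge s t | s t. s \<in> terms_over B n \<and> t \<in> terms_over B n}"

primrec term_val :: "(nat \<Rightarrow> 'b) \<Rightarrow> 'b lg_term \<Rightarrow> 'b" where
  "term_val p (Var k) = p k"
| "term_val p (Const b) = b"

primrec satisfies :: "'b Lg_structure \<Rightarrow> (nat \<Rightarrow> 'b) \<Rightarrow> 'b equation \<Rightarrow> bool" where
  "satisfies B p (Equal s t) \<longleftrightarrow> term_val p s = term_val p t"
| "satisfies B p (Edge s t) \<longleftrightarrow> adj B (term_val p s) (term_val p t)"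

definition solution_set :: "'b Lg_structure \<Rightarrow> nat \<Rightarrow> 'b equation set \<Rightarrow> (nat \<Rightarrow> 'b) set" where
  "solution_set B n S = {p \<in> {..<n} \<rightarrow>\<^sub>E universe B. \<forall>e\<in>S. satisfies B p e}"

definition equivalent_over ::
    "'b Lg_structure \<Rightarrow> nat \<Rightarrow> 'b equation set \<Rightarrow> 'b equation set \<Rightarrow> bool" where
  "equivalent_over B n S T \<longleftrightarrow> solution_set B n S = solution_set B n T"

definition equationally_noetherian :: "'b Lg_structure \<Rightarrow> bool" where
  "equationally_noetherian B \<longleftrightarrow>
     (\<forall>n S. S \<subseteq> equations_over B n \<and> infinite S \<longrightarrow>
        (\<exists>S'. S' \<subseteq> S \<and> finite S' \<and> equivalent_over B n S S'))"

end

(* Call a graph satisfying the quasi-identity Q.  Q says that two neighbourhoods which meet are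
   equal, and it passes to direct powers.  Hence, among the equations that differ only in their
   constants, any two have equal or disjoint solution sets, so at most two equations of each of the
   finitely many such shapes determine the whole system.  Conversely, let x1, x2, x3, x4 be a path
   with x4 not adjacent to x1.  Let c j have x4 at coordinate j and x2 elsewhere.  A point with
   coordinates in {x1, x3} is adjacent to c j iff its coordinate at j is x3, so in the system
   E(x, c j), j in I, every finite subsystem has solutions that the system has not. *)

theory Submission
  imports Defs
begin

text \<open>Within a fibre of \<open>f\<close>, either some two of the sets are disjoint and already
  intersect in nothing, or all are equal and one stands for the rest. Collecting these at most two
  indices per value of \<open>f\<close> keeps \<open>T\<close> finite.\<close>

lemma finite_subfamily_Inter_eq:
  assumes fin: "finite (f ` S)"
    and eq_or_disjoint: "\<And>d e. \<lbrakk>d \<in> S; e \<in> S; f d = f e\<rbrakk> \<Longrightarrow> A d = A e \<or> A d \<inter> A e = {}"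
  obtains T where "T \<subseteq> S" "finite T" "(\<Inter>e\<in>T. A e) = (\<Inter>e\<in>S. A e)"
proof -
  have "\<exists>T. T \<subseteq> S \<and> finite T \<and> (\<forall>e\<in>S. f e = c \<longrightarrow> (\<Inter>d\<in>T. A d) \<subseteq> A e)"
    if "c \<in> f ` S" for c
  proof -
    from that obtain d where d: "d \<in> S" "f d = c" by blast
    show ?thesis
    proof (cases "\<exists>e\<in>S. f e = c \<and> A e \<noteq> A d")
      case True
      then obtain e where e: "e \<in> S" "f e = c" "A e \<noteq> A d" by blast
      with d eq_or_disjoint[of d e] have "A d \<inter> A e = {}" by simp
      with d(1) e(1) show ?thesis by (intro exI[of _ "{d, e}"]) simp
    next
      case False
      then have "A d \<subseteq> A e" if "e \<in> S" "f e = c" for e using that by blast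
      with d show ?thesis by (intro exI[of _ "{d}"]) simp
    qed
  qed
  then obtain T where T: "\<forall>c\<in>f ` S.
      T c \<subseteq> S \<and> finite (T c) \<and> (\<forall>e\<in>S. f e = c \<longrightarrow> (\<Inter>d\<in>T c. A d) \<subseteq> A e)"
    using bchoice[OF ballI, of "f ` S"] by (metis (no_types, lifting))
  let ?T = "\<Union>c\<in>f ` S. T c"
  have sub: "?T \<subseteq> S"
    using T by (simp add: UN_subset_iff)
  have "(\<Inter>d\<in>?T. A d) \<subseteq> A e" if "e \<in> S" for e
  proof -
    have "(\<Inter>d\<in>?T. A d) \<subseteq> (\<Inter>d\<in>T (f e). A d)"
      using that by (intro INF_superset_mono) auto
    also have "\<dots> \<subseteq> A e"
      using T that by simp
    finally show ?thesis .
  qed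
  then have "(\<Inter>d\<in>?T. A d) = (\<Inter>e\<in>S. A e)"
    using sub by (intro equalityI INF_greatest INF_superset_mono) auto
  moreover have "finite ?T"
    using T by (intro finite_UN_I[OF fin]) blast
  ultimately show thesis
    using that sub by blast
qed

text \<open>Blurring all constants into one puts into a common fibre the equations whose solution
  sets are to be compared. With \<open>n\<close> variables and one blurred constant, only finitely
  many fibres arise.\<close>

abbreviation equation_shape :: "'b equation \<Rightarrow> unit equation" where
  "equation_shape \<equiv> map_equation (\<lambda>_. ())"

lemma finite_equation_shapes: "finite (equation_shape ` equations_over B n)"
proof -
  let ?T = "Var ` {..<n} \<union> {Const ()}"
  have "map_lg_term (\<lambda>_. ()) t \<in> ?T" if "t \<in> terms_over B n" for t
    using that by (auto simp: terms_over_def)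
  then have "equation_shape ` equations_over B n \<subseteq>
      (\<lambda>(s, t). Equal s t) ` (?T \<times> ?T) \<union> (\<lambda>(s, t). Edge s t) ` (?T \<times> ?T)"
    unfolding equations_over_def by fastforce
  then show ?thesis by (rule finite_subset) simp
qed

definition four_cycle_closed :: "'a Lg_structure \<Rightarrow> bool" where
  "four_cycle_closed G \<longleftrightarrow>
    (\<forall>x1\<in>universe G. \<forall>x2\<in>universe G. \<forall>x3\<in>universe G. \<forall>x4\<in>universe G.
       adj G x1 x2 \<and> adj G x2 x3 \<and> adj G x3 x4 \<longrightarrow> adj G x4 x1)"

text \<open>The path \<open>y\<close>, \<open>b\<close>, \<open>x\<close>, \<open>c\<close> closes
  up to a four-cycle.\<close>

lemma four_cycle_closed_neighbourhood_mono:
  assumes "is_graph B" "four_cycle_closed B"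
    and "b \<in> universe B" "c \<in> universe B" "x \<in> universe B" "y \<in> universe B"
    and "adj B x b" "adj B x c" "adj B y b"
  shows "adj B y c"
proof -
  have "adj B b x" using assms by (simp add: is_graph_def)
  with assms have "adj B c y"
    unfolding four_cycle_closed_def by blast
  with assms show ?thesis by (simp add: is_graph_def)
qed

text \<open>This is one inclusion between solution sets that share the point \<open>p\<close>;
  exchanging \<open>d\<close> and \<open>e\<close> gives the other. Only an edge between a variable
  and a constant calls on the quasi-identity.\<close>

lemma same_shape_satisfies:
  assumes B: "is_graph B" "four_cycle_closed B"
    and eqs: "d \<in> equations_over B n" "e \<in> equations_over B n"
    and shape: "equation_shape d = equation_shape e"
    and p: "p \<in> {..<n} \<rightarrow>\<^sub>E universe B" and q: "q \<in> {..<n} \<rightarrow>\<^sub>E universe B"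
    and sat: "satisfies B p d" "satisfies B p e" "satisfies B q d"
  shows "satisfies B q e"
proof -
  have pq: "p k \<in> universe B" "q k \<in> universe B" if "k < n" for k
    using p q that by auto
  have sym: "adj B y x" if "adj B x y" "x \<in> universe B" "y \<in> universe B" for x y
    using B that by (auto simp: is_graph_def)
  note mono = four_cycle_closed_neighbourhood_mono[OF B]
  consider s t s' t' where "d = Equal s t" "e = Equal s' t'"
    | s t s' t' where "d = Edge s t" "e = Edge s' t'"
    using shape by (cases d; cases e) auto
  then show ?thesis
  proof cases
    case 1
    then show ?thesis
      \<comment> \<open>Where a constant faces a variable, the value of \<open>p\<close> forces the
        constants of \<open>d\<close> and \<open>e\<close> to coincide. Between two constants, the
        truth of \<open>e\<close> does not depend on the point.\<close>
      using shape sat by (cases s; cases s'; cases t; cases t') auto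
  next
    case 2
    then have "s \<in> terms_over B n" "t \<in> terms_over B n" "s' \<in> terms_over B n" "t' \<in> terms_over B n"
      using eqs by (auto simp: equations_over_def)
    then have univ: "term_val r u \<in> universe B" if "r \<in> {p, q}" "u \<in> {s, t, s', t'}" for r u
      using that pq by (auto simp: terms_over_def)
    from shape 2 have shapes: "map_lg_term (\<lambda>_. ()) s = map_lg_term (\<lambda>_. ()) s'"
      "map_lg_term (\<lambda>_. ()) t = map_lg_term (\<lambda>_. ()) t'" by simp_all
    show ?thesis
    proof (cases s)
      case (Var k)
      then have s': "s' = Var k" using shapes by (cases s') auto
      show ?thesis
      proof (cases t)
        case (Var l)
        then have "t' = Var l" using shapes by (cases t') auto
        with 2 Var s' \<open>s = _\<close> sat show ?thesis by simp
      next
        case (Const b)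
        then obtain c where "t' = Const c" using shapes by (cases t') auto
        \<comment> \<open>\<open>p k\<close> is a common neighbour of \<open>b\<close> and
          \<open>c\<close>, so \<open>q k\<close>, being adjacent to \<open>b\<close>, is adjacent
          to \<open>c\<close>.\<close>
        with 2 Const s' \<open>s = _\<close> sat show ?thesis
          using univ[of p s] univ[of q s] univ[of p t] univ[of p t'] mono[of b c "p k" "q k"]
          by simp
      qed
    next
      case (Const b)
      then obtain c where s': "s' = Const c" using shapes by (cases s') auto
      show ?thesis
      proof (cases t)
        case (Var l)
        then have "t' = Var l" using shapes by (cases t') auto
        \<comment> \<open>Symmetry of the edge relation moves the constant to the right, as in the
          previous case.\<close>
        with 2 Var s' \<open>s = _\<close> sat show ?thesis
          using univ[of p s] univ[of p s'] univ[of p t] univ[of q t] mono[of b c "p l" "q l"]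
          by (simp add: sym)
      next
        case (Const b')
        then obtain c' where "t' = Const c'" using shapes by (cases t') auto
        with 2 s' sat show ?thesis by simp
      qed
    qed
  qed
qed

lemma four_cycle_closed_imp_noetherian:
  assumes B: "is_graph B" "four_cycle_closed B"
  shows "equationally_noetherian B"
  unfolding equationally_noetherian_def
proof (intro allI impI)
  fix n S
  assume S: "S \<subseteq> equations_over B n \<and> infinite S"
  let ?U = "{..<n} \<rightarrow>\<^sub>E universe B"
  define A where "A e = {p \<in> ?U. satisfies B p e}" for e
  \<comment> \<open>The factor \<open>?U\<close> matters for empty \<open>R\<close>, where the
    intersection of the \<open>A e\<close> is the whole type.\<close>
  have sol: "solution_set B n R = ?U \<inter> (\<Inter>e\<in>R. A e)" for R
    by (auto simp: solution_set_def A_def)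
  have fin: "finite (equation_shape ` S)"
    using S finite_equation_shapes[of B n] by (meson finite_subset image_mono)
  have "A d = A e \<or> A d \<inter> A e = {}"
    if "d \<in> S" "e \<in> S" "equation_shape d = equation_shape e" for d e
  proof -
    have de: "d \<in> equations_over B n" "e \<in> equations_over B n"
      using S that by auto
    show ?thesis
      using same_shape_satisfies[OF B de that(3)] same_shape_satisfies[OF B de(2,1) that(3)[symmetric]]
      unfolding A_def by blast
  qed
  with fin obtain T where T: "T \<subseteq> S" "finite T" "(\<Inter>e\<in>T. A e) = (\<Inter>e\<in>S. A e)"
    using finite_subfamily_Inter_eq[of equation_shape S A] by metis
  then show "\<exists>S'. S' \<subseteq> S \<and> finite S' \<and> equivalent_over B n S S'"
    by (intro exI[of _ T]) (simp add: equivalent_over_def sol)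
qed

text \<open>Irreflexivity is refuted or confirmed at a coordinate, so one must exist: over an empty
  index set the only element would carry a loop.\<close>

lemma is_graph_direct_power:
  assumes "is_graph G" "I \<noteq> {}"
  shows "is_graph (direct_power I G)"
proof -
  obtain i where "i \<in> I" using assms(2) by blast
  moreover have "\<not> adj G (a i) (a i)" if "a \<in> I \<rightarrow>\<^sub>E universe G" "i \<in> I" for a i
    using assms(1) that by (simp add: is_graph_def PiE_iff)
  moreover have "adj G (b i) (a i)"
    if "a \<in> I \<rightarrow>\<^sub>E universe G" "b \<in> I \<rightarrow>\<^sub>E universe G" "adj G (a i) (b i)" "i \<in> I" for a b i
    using assms(1) that by (simp add: is_graph_def PiE_iff)
  ultimately show ?thesis
    unfolding is_graph_def direct_power_def Lg_structure.simps by blast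
qed

lemma four_cycle_closed_direct_power:
  assumes "four_cycle_closed G"
  shows "four_cycle_closed (direct_power I G)"
  unfolding four_cycle_closed_def
proof (intro ballI impI)
  fix a b c d
  assume "a \<in> universe (direct_power I G)" "b \<in> universe (direct_power I G)"
    "c \<in> universe (direct_power I G)" "d \<in> universe (direct_power I G)"
    and "adj (direct_power I G) a b \<and> adj (direct_power I G) b c \<and> adj (direct_power I G) c d"
  then have "adj G (d i) (a i)" if "i \<in> I" for i
    using that assms[unfolded four_cycle_closed_def, rule_format, of "a i" "b i" "c i" "d i"]
    by (simp add: direct_power_def PiE_iff)
  then show "adj (direct_power I G) d a"
    by (simp add: direct_power_def)
qed

lemma noetherian_direct_power_imp_four_cycle_closed:
  assumes graph: "is_graph G" and inf: "infinite I"
    and noeth: "equationally_noetherian (direct_power I G)"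
  shows "four_cycle_closed G"
  unfolding four_cycle_closed_def
proof (intro ballI impI, elim conjE, rule ccontr)
  fix x1 x2 x3 x4
  assume x: "x1 \<in> universe G" "x2 \<in> universe G" "x3 \<in> universe G" "x4 \<in> universe G"
    and path: "adj G x1 x2" "adj G x2 x3" "adj G x3 x4" and open_path: "\<not> adj G x4 x1"
  let ?B = "direct_power I G"
  have adj: "adj G x3 x2" "\<not> adj G x1 x4"
    using graph x path open_path by (auto simp: is_graph_def)
  \<comment> \<open>\<open>x1\<close> is adjacent to \<open>x2\<close> but not to \<open>x4\<close>.
    This makes the constants \<open>c j\<close> distinct and the system infinite.\<close>
  then have "x2 \<noteq> x4" using path by auto
  define c where "c j = (\<lambda>i\<in>I. if i = j then x4 else x2)" for j
  define S where "S = (\<lambda>j. Edge (Var 0) (Const (c j))) ` I"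
  have "inj_on c I"
  proof
    fix j k
    assume "j \<in> I" "k \<in> I" "c j = c k"
    then show "j = k" using \<open>x2 \<noteq> x4\<close> by (auto simp: c_def dest: fun_cong[of _ _ j] split: if_splits)
  qed
  then have "inj_on (\<lambda>j. Edge (Var 0) (Const (c j))) I"
    by (auto simp: inj_on_def)
  then have "infinite S"
    using inf by (simp add: S_def finite_image_iff)
  moreover have "S \<subseteq> equations_over ?B 1"
    using x by (auto simp: S_def equations_over_def terms_over_def direct_power_def c_def)
  ultimately obtain S' where S': "S' \<subseteq> S" "finite S'" "solution_set ?B 1 S = solution_set ?B 1 S'"
    using noeth[unfolded equationally_noetherian_def equivalent_over_def, rule_format, of S 1] by blast
  obtain J where J: "J \<subseteq> I" "finite J" "S' = (\<lambda>j. Edge (Var 0) (Const (c j))) ` J"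
    using finite_subset_image[OF S'(2) S'(1)[unfolded S_def]] by blast
  \<comment> \<open>The single variable gets the value \<open>x3\<close> on \<open>J\<close> and
    \<open>x1\<close> off \<open>J\<close>: \<open>x3\<close> is adjacent to both \<open>x2\<close>
    and \<open>x4\<close>, but \<open>x1\<close> only to \<open>x2\<close>. Hence equation
    \<open>j\<close> can fail only at coordinate \<open>j\<close>, and does so exactly off
    \<open>J\<close>.\<close>
  define p where "p = (\<lambda>k\<in>{..<1::nat}. \<lambda>i\<in>I. if i \<in> J then x3 else x1)"
  have p: "p \<in> {..<1} \<rightarrow>\<^sub>E universe ?B"
    using x by (auto simp: p_def direct_power_def)
  have sat: "satisfies ?B p (Edge (Var 0) (Const (c j))) \<longleftrightarrow> j \<in> J" if "j \<in> I" for j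
    using that path adj by (auto simp: p_def c_def direct_power_def)
  then have "p \<in> solution_set ?B 1 S'"
    using p J by (auto simp: solution_set_def)
  then have "p \<in> solution_set ?B 1 S"
    using S' by simp
  \<comment> \<open>Solving all of \<open>S\<close> puts every index into the finite set
    \<open>J\<close>.\<close>
  then have "I \<subseteq> J"
    using sat by (auto simp: solution_set_def S_def)
  then show False
    using inf \<open>finite J\<close> finite_subset by blast
qed

theorem theorem3p1:
  fixes G :: "'a Lg_structure" and I :: "'i set"
  assumes "is_graph G" and "infinite I"
  shows "equationally_noetherian (direct_power I G) \<longleftrightarrow>
    (\<forall>x1\<in>universe G. \<forall>x2\<in>universe G. \<forall>x3\<in>universe G. \<forall>x4\<in>universe G.
       adj G x1 x2 \<and> adj G x2 x3 \<and> adj G x3 x4 \<longrightarrow> adj G x4 x1)"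
proof -
  have "I \<noteq> {}" using assms(2) by auto
  then have "equationally_noetherian (direct_power I G) \<longleftrightarrow> four_cycle_closed G"
    using assms noetherian_direct_power_imp_four_cycle_closed four_cycle_closed_imp_noetherian
      is_graph_direct_power four_cycle_closed_direct_power
    by metis
  then show ?thesis unfolding four_cycle_closed_def .
qed

end
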